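(* Let $K\ge2$, let $p$ be a prime and let $n,m$ be nonnegative integers. The symmetric feedback capacity of the linear deterministic $K$-user fully connected interference channel with parameters $n$ and $m$ (over the field with $p$ elements) is $$R_{\mathrm{sym}}=\begin{cases} n-\dfrac m2, & n>m,\\[2mm] \dfrac nK, & m=n,\\[2mm] \dfrac m2, & n<m.\end{cases}$$
   Context: Let $\mathbb F$ be the field with $p$ elements and $q=\max\{m,n\}$. Let $D$ be the $q\times q$ down-shift matrix over $\mathbb F$ (ones on the first subdiagonal, zeros elsewhere; $D^0=I$). There are $K$ transmitter–receiver pairs. In each channel use, transmitter $k$ sends $X_k\in\mathbb F^q$ and receiver $k$ observes $$Y_k=D^{q-n}X_k+\sum_{i\ne k}D^{q-m}X_i\in\mathbb F^q .$$ Transmitter $k$ has a message $W_k$ for receiver $k$; the messages are independent and uniformly distributed. Feedback: the input of transmitter $k$ at time $t$ is a function $X_{kt}=f_{kt}(W_k,Y_{k1},\dots,Y_{k(t-1)})$ of its own message and the past outputs of its own receiver. Receiver $k$ decodes $W_k$ from $Y_{k1},\dots,Y_{kT}$, where $T$ is the block length. Rates are measured in $p$-ary symbols per channel use (logarithms to base $p$). A tuple $(R_1,\dots,R_K)$ is achievable if there are such codes with message sets of size at least $p^{TR_k}$ whose average decoding error probability tends to $0$ for all users as $T\to\infty$. The symmetric feedback capacity $R_{\mathrm{sym}}$ is the supremum of all $R$ such that $(R,\dots,R)$ is achievable. *)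

theory Defs
  imports "HOL-Probability.Product_PMF" "Jordan_Normal_Form.Matrix"
begin

text \<open>Users are numbered \<open>0, \<dots>, K - 1\<close>, and channel uses are numbered from \<open>0\<close>.\<close>

definition shift_mat :: "nat \<Rightarrow> 'f::field mat" where
  "shift_mat q = mat q q (\<lambda>(i, j). if i = j + 1 then 1 else 0)"

definition channel_output ::
  "nat \<Rightarrow> nat \<Rightarrow> nat \<Rightarrow> (nat \<Rightarrow> 'f::field vec) \<Rightarrow> nat \<Rightarrow> 'f vec" where
  "channel_output K n m X k = (let q = max m n; D = shift_mat q in
     (D ^\<^sub>m (q - n)) *\<^sub>v X k
       + finsum_vec TYPE('f) q (\<lambda>i. (D ^\<^sub>m (q - m)) *\<^sub>v X i) ({..<K} - {k}))"

text \<open>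
  The message set of user \<open>k\<close> is \<open>{..<msgs C k}\<close>.  The argument order of \<open>enc\<close> is user, channel use,
  own message, past outputs at the own receiver (oldest first).
\<close>

record 'f feedback_code =
  msgs :: "nat \<Rightarrow> nat"
  enc :: "nat \<Rightarrow> nat \<Rightarrow> nat \<Rightarrow> 'f vec list \<Rightarrow> 'f vec"
  dec :: "nat \<Rightarrow> 'f vec list \<Rightarrow> nat"

definition is_feedback_code ::
  "nat \<Rightarrow> nat \<Rightarrow> nat \<Rightarrow> nat \<Rightarrow> 'f::field feedback_code \<Rightarrow> bool" where
  "is_feedback_code K n m T C \<longleftrightarrow>
     (\<forall>k<K. msgs C k > 0 \<and>
       (\<forall>t<T. \<forall>w<msgs C k. \<forall>ys. length ys = t \<and> set ys \<subseteq> carrier_vec (max m n) \<longrightarrow>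
          enc C k t w ys \<in> carrier_vec (max m n)))"

text \<open>The outputs at receiver \<open>k\<close> in the first \<open>t\<close> channel uses when the messages are \<open>w\<close>.\<close>

primrec outputs ::
  "nat \<Rightarrow> nat \<Rightarrow> nat \<Rightarrow> 'f::field feedback_code \<Rightarrow> (nat \<Rightarrow> nat) \<Rightarrow> nat \<Rightarrow> nat \<Rightarrow> 'f vec list" where
  "outputs K n m C w 0 = (\<lambda>k. [])"
| "outputs K n m C w (Suc t) = (\<lambda>k. outputs K n m C w t k
     @ [channel_output K n m (\<lambda>i. enc C i t (w i) (outputs K n m C w t i)) k])"

text \<open>Independent, uniformly distributed messages; the value \<open>0\<close> outside \<open>{..<K}\<close> is irrelevant.\<close>

definition message_pmf :: "nat \<Rightarrow> 'f feedback_code \<Rightarrow> (nat \<Rightarrow> nat) pmf" where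
  "message_pmf K C = Pi_pmf {..<K} 0 (\<lambda>k. pmf_of_set {..<msgs C k})"

definition error_prob ::
  "nat \<Rightarrow> nat \<Rightarrow> nat \<Rightarrow> nat \<Rightarrow> 'f::field feedback_code \<Rightarrow> nat \<Rightarrow> real" where
  "error_prob K n m T C k =
     measure_pmf.prob (message_pmf K C) {w. dec C k (outputs K n m C w T k) \<noteq> w k}"

definition achievable ::
  "'f::{field,finite} itself \<Rightarrow> nat \<Rightarrow> nat \<Rightarrow> nat \<Rightarrow> (nat \<Rightarrow> real) \<Rightarrow> bool" where
  "achievable _ K n m R \<longleftrightarrow>
     (\<exists>C :: nat \<Rightarrow> 'f feedback_code.
        (\<forall>T\<ge>1. is_feedback_code K n m T (C T) \<and>
           (\<forall>k<K. real (msgs (C T) k) \<ge> real CARD('f) powr (real T * R k))) \<and>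
        (\<forall>k<K. (\<lambda>T. error_prob K n m T (C T) k) \<longlonglongrightarrow> 0))"

text \<open>
  The supremum is taken in the extended reals, so that a real value of the capacity includes the
  claim that the set of achievable rates is nonempty and bounded above.
\<close>

definition sym_feedback_capacity ::
  "'f::{field,finite} itself \<Rightarrow> nat \<Rightarrow> nat \<Rightarrow> nat \<Rightarrow> ereal" where
  "sym_feedback_capacity F K n m = Sup {ereal R | R. achievable F K n m (\<lambda>k. R)}"

end

theory Submission
  imports Defs
begin

text \<open>
  Achievability: a zero-error linear scheme on a short block of channel uses is repeated.  After
  one channel use, feedback lets every transmitter compute the sum of all inputs on the levels that
  interfere; transmitting this sum once more resolves the interference at all receivers
  simultaneously.  For \<open>m = n\<close> the users take turns.

  Converse: fix the messages of all users except \<open>0\<close> and \<open>1\<close>.  If both decode correctly, the outputs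
  at receiver \<open>0\<close> together with the entries of the inputs of transmitter \<open>1\<close> at the levels
  \<open>m, \<dots>, n - 1\<close> determine everything: they determine the message of user \<open>0\<close>, then, one channel
  use after the other, all inputs and outputs, and hence the message of user \<open>1\<close>.  Counting correctly
  decoded message tuples gives \<open>2 R \<le> max m n + (n - m)\<close> (truncated difference).  For \<open>m = n\<close> all
  receivers see the same output and decode all messages, so that \<open>K R \<le> n\<close>.
\<close>

text \<open>The bundle clashes with the component notation of \<open>Jordan_Normal_Form\<close>.\<close>

unbundle no vec_syntax

subsection \<open>The channel\<close>

lemma shift_mat_carrier [simp]: "shift_mat q \<in> carrier_mat q q"
  by (simp add: shift_mat_def)

lemma shift_mat_pow_carrier [simp]: "shift_mat q ^\<^sub>m s \<in> carrier_mat q q"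
  by (simp add: pow_carrier_mat)

lemma dim_shift_mat [simp]: "dim_row (shift_mat q) = q" "dim_col (shift_mat q) = q"
  by (simp_all add: shift_mat_def)

lemma shift_mat_pow_index:
  assumes "i < q" "j < q"
  shows "(shift_mat q ^\<^sub>m s :: 'f::field mat) $$ (i, j) = (if i = j + s then 1 else 0)"
  using assms
proof (induction s arbitrary: j)
  case 0
  then show ?case by (simp add: shift_mat_def)
next
  case (Suc s)
  have "(shift_mat q ^\<^sub>m Suc s :: 'f mat) $$ (i, j)
      = (\<Sum>l<q. (shift_mat q ^\<^sub>m s :: 'f mat) $$ (i, l) * (shift_mat q :: 'f mat) $$ (l, j))"
    using Suc.prems by (simp add: scalar_prod_def atLeast0LessThan)
  also have "\<dots> = (\<Sum>l<q. if l = j + 1 then (if i = j + 1 + s then 1 else 0) else 0)"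
    using Suc by (intro sum.cong) (auto simp: shift_mat_def)
  also have "\<dots> = (if i = j + Suc s then 1 else 0)"
    using Suc.prems by simp
  finally show ?case .
qed

lemma shift_mat_pow_mult_vec_index:
  assumes "x \<in> carrier_vec q" "i < q"
  shows "((shift_mat q ^\<^sub>m s) *\<^sub>v x) $ i = (if s \<le> i then x $ (i - s) else (0::'f::field))"
proof -
  have "((shift_mat q ^\<^sub>m s) *\<^sub>v x) $ i = (\<Sum>j<q. (shift_mat q ^\<^sub>m s) $$ (i, j) * x $ j)"
    using assms by (simp add: scalar_prod_def atLeast0LessThan)
  also have "\<dots> = (\<Sum>j<q. if j = i - s then (if s \<le> i then x $ (i - s) else 0) else 0)"
    using assms by (intro sum.cong) (auto simp: shift_mat_pow_index)
  finally show ?thesis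
    using assms(2) by auto
qed

lemma channel_output_carrier:
  assumes "\<And>i. i < K \<Longrightarrow> X i \<in> carrier_vec (max m n)" "k < K"
  shows "channel_output K n m X k \<in> carrier_vec (max m n)"
  using assms
  by (auto simp: channel_output_def Let_def intro!: add_carrier_vec finsum_vec_closed
      mult_mat_vec_carrier[OF shift_mat_pow_carrier])

lemma channel_output_index:
  fixes X :: "nat \<Rightarrow> 'f::field vec"
  assumes X: "\<And>i. i < K \<Longrightarrow> X i \<in> carrier_vec (max m n)" and "k < K" "j < max m n"
  shows "channel_output K n m X k $ j =
    (if max m n - n \<le> j then X k $ (j - (max m n - n)) else 0)
    + (if max m n - m \<le> j then \<Sum>i\<in>{..<K} - {k}. X i $ (j - (max m n - m)) else 0)"
proof -
  let ?D = "\<lambda>s. shift_mat (max m n) ^\<^sub>m (max m n - s) :: 'f mat"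
  let ?S = "finsum_vec TYPE('f) (max m n) (\<lambda>i. ?D m *\<^sub>v X i) ({..<K} - {k})"
  have *: "(\<lambda>i. ?D m *\<^sub>v X i) \<in> {..<K} - {k} \<rightarrow> carrier_vec (max m n)"
    by (auto intro: mult_mat_vec_carrier[OF shift_mat_pow_carrier] X)
  have "?S \<in> carrier_vec (max m n)"
    using finsum_vec_closed[OF *] .
  moreover have "?S $ j = (\<Sum>i\<in>{..<K} - {k}. (?D m *\<^sub>v X i) $ j)"
    using * \<open>j < max m n\<close> by (intro index_finsum_vec) auto
  moreover have "\<dots> = (if s \<le> j then \<Sum>i\<in>{..<K} - {k}. X i $ (j - s) else 0)" if "s = max m n - m" for s
    unfolding that[symmetric] using assms by (simp add: shift_mat_pow_mult_vec_index del: index_mult_mat_vec)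
  moreover have "(?D n *\<^sub>v X k) $ j = (if max m n - n \<le> j then X k $ (j - (max m n - n)) else 0)"
    using assms by (intro shift_mat_pow_mult_vec_index) auto
  ultimately show ?thesis
    using \<open>j < max m n\<close> by (simp only: channel_output_def Let_def index_add_vec carrier_vecD)
qed

text \<open>The sum over all users, unlike the sum over the interferers, does not depend on the
  receiver. It is the quantity that feedback lets every transmitter learn.\<close>

lemma channel_output_index_total:
  fixes X :: "nat \<Rightarrow> 'f::field vec"
  assumes "\<And>i. i < K \<Longrightarrow> X i \<in> carrier_vec (max m n)" and "k < K" "j < max m n"
  shows "channel_output K n m X k $ j =
    (if max m n - n \<le> j then X k $ (j - (max m n - n)) else 0)
    + (if max m n - m \<le> j then (\<Sum>i<K. X i $ (j - (max m n - m))) - X k $ (j - (max m n - m)) else 0)"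
proof -
  have "(\<Sum>i\<in>{..<K} - {k}. X i $ l) = (\<Sum>i<K. X i $ l) - X k $ l" for l
    using \<open>k < K\<close> by (simp add: sum_diff1)
  then show ?thesis
    by (simp only: channel_output_index[where X = X, OF assms])
qed

lemma channel_output_direct:
  assumes "m < n" "\<And>i. i < K \<Longrightarrow> X i \<in> carrier_vec n" "k < K" "j < n"
  shows "channel_output K n m X k $ j =
    X k $ j + (if n - m \<le> j then (\<Sum>i<K. X i $ (j - (n - m))) - X k $ (j - (n - m)) else 0)"
proof -
  have "max m n = n"
    using assms by simp
  then show ?thesis
    using channel_output_index_total[where X = X and m = m and n = n and K = K and k = k and j = j]
      assms(2-4) by simp
qed

lemma channel_output_cross:
  assumes "n < m" "\<And>i. i < K \<Longrightarrow> X i \<in> carrier_vec m" "k < K" "j < m"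
  shows "channel_output K n m X k $ j =
    (if m - n \<le> j then X k $ (j - (m - n)) else 0) + ((\<Sum>i<K. X i $ j) - X k $ j)"
proof -
  have "max m n = m"
    using assms by simp
  then show ?thesis
    using channel_output_index_total[where X = X and m = m and n = n and K = K and k = k and j = j]
      assms(2-4) by simp
qed

text \<open>With \<open>m = n\<close> the subtracted own input cancels against the direct link, so
  every output is the sum of all inputs.\<close>

lemma channel_output_equal_gains:
  assumes "\<And>i. i < K \<Longrightarrow> X i \<in> carrier_vec n" "k < K" "l < K"
  shows "channel_output K n n X k = channel_output K n n X l"
proof (rule eq_vecI)
  have "channel_output K n n X k \<in> carrier_vec n" "channel_output K n n X l \<in> carrier_vec n"
    using channel_output_carrier[of K X n n] assms by simp_all
  then show "dim_vec (channel_output K n n X k) = dim_vec (channel_output K n n X l)"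
    and "\<And>j. j < dim_vec (channel_output K n n X l) \<Longrightarrow>
      channel_output K n n X k $ j = channel_output K n n X l $ j"
    using assms channel_output_index_total[of K X n n] by auto
qed

subsection \<open>Transmission with feedback\<close>

text \<open>Outputs when transmitter \<open>i\<close> uses the strategy \<open>e i\<close>, in which its message is already fixed.\<close>

primrec run ::
  "nat \<Rightarrow> nat \<Rightarrow> nat \<Rightarrow> (nat \<Rightarrow> nat \<Rightarrow> 'f::field vec list \<Rightarrow> 'f vec) \<Rightarrow> nat \<Rightarrow> nat \<Rightarrow> 'f vec list" where
  "run K n m e 0 = (\<lambda>k. [])"
| "run K n m e (Suc t) =
    (\<lambda>k. run K n m e t k @ [channel_output K n m (\<lambda>i. e i t (run K n m e t i)) k])"

text \<open>Separates the channel dynamics from the message type, so that the same recursion serves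
  block codes whose messages are vectors or pairs of vectors.\<close>

lemma outputs_eq_run: "outputs K n m C w t = run K n m (\<lambda>i t. enc C i t (w i)) t"
  by (induction t) auto

lemma length_run [simp]: "length (run K n m e t k) = t"
  by (induction t) auto

lemma take_run: "t \<le> T \<Longrightarrow> take t (run K n m e T k) = run K n m e t k"
  by (induction T) (auto simp: le_Suc_eq)

definition valid_strategy ::
  "nat \<Rightarrow> nat \<Rightarrow> nat \<Rightarrow> (nat \<Rightarrow> 'f::field vec list \<Rightarrow> 'f vec) \<Rightarrow> bool" where
  "valid_strategy n m T e \<longleftrightarrow>
    (\<forall>t<T. \<forall>ys. length ys = t \<and> set ys \<subseteq> carrier_vec (max m n) \<longrightarrow> e t ys \<in> carrier_vec (max m n))"

lemma run_carrier:
  assumes "\<And>i. i < K \<Longrightarrow> valid_strategy n m T (e i)" "t \<le> T" "k < K"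
  shows "set (run K n m e t k) \<subseteq> carrier_vec (max m n)"
  using assms(2,3)
proof (induction t arbitrary: k)
  case (Suc t)
  have "e i t (run K n m e t i) \<in> carrier_vec (max m n)" if "i < K" for i
    using assms(1)[OF that] Suc.IH[of i] Suc.prems that by (auto simp: valid_strategy_def)
  then show ?case
    using Suc channel_output_carrier[of K "\<lambda>i. e i t (run K n m e t i)" m n k] by auto
qed auto

lemma run_input_carrier:
  assumes "\<And>i. i < K \<Longrightarrow> valid_strategy n m T (e i)" "t < T" "i < K"
  shows "e i t (run K n m e t i) \<in> carrier_vec (max m n)"
  using assms(2,3) assms(1)[OF assms(3)] run_carrier[where e = e and T = T and t = t and k = i, OF assms(1)]
  by (auto simp: valid_strategy_def)

lemma nth_run:
  assumes "t < T"
  shows "run K n m e T k ! t = channel_output K n m (\<lambda>i. e i t (run K n m e t i)) k"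
proof -
  have "run K n m e T k ! t = take (Suc t) (run K n m e T k) ! t"
    by simp
  also have "\<dots> = run K n m e (Suc t) k ! t"
    using assms by (subst take_run) auto
  finally show ?thesis
    by (simp add: nth_append)
qed

lemma nth_run_mono:
  assumes "t < s" "s \<le> T"
  shows "run K n m e s k ! t = run K n m e T k ! t"
  using assms by (simp add: nth_run)

lemma valid_strategy_enc:
  fixes C :: "'f::field feedback_code"
  assumes "is_feedback_code K n m T C" "i < K" "x < msgs C i"
  shows "valid_strategy n m T (\<lambda>t. enc C i t x)"
  unfolding valid_strategy_def
proof (intro allI impI)
  fix t and ys :: "'f vec list"
  assume "t < T" "length ys = t \<and> set ys \<subseteq> carrier_vec (max m n)"
  then show "enc C i t x ys \<in> carrier_vec (max m n)"
    using assms unfolding is_feedback_code_def by metis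
qed

section \<open>Error probabilities as counts of message tuples\<close>

lemma message_pmf_eq:
  assumes "\<And>k. k < K \<Longrightarrow> msgs C k > 0"
  shows "message_pmf K C = pmf_of_set (PiE_dflt {..<K} 0 (\<lambda>k. {..<msgs C k}))"
  unfolding message_pmf_def using assms by (intro Pi_pmf_of_set) auto

lemma error_prob_eq:
  assumes "\<And>k. k < K \<Longrightarrow> msgs C k > 0"
  shows "error_prob K n m T C k =
    card {w \<in> PiE_dflt {..<K} 0 (\<lambda>k. {..<msgs C k}). dec C k (outputs K n m C w T k) \<noteq> w k}
    / (\<Prod>k<K. msgs C k)"
proof -
  let ?A = "PiE_dflt {..<K} 0 (\<lambda>k. {..<msgs C k})"
  have "?A \<noteq> {}" "finite ?A" "card ?A = (\<Prod>k<K. msgs C k)"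
    using assms by (auto simp: card_PiE_dflt)
  then show ?thesis
    by (simp add: error_prob_def message_pmf_eq[OF assms] measure_pmf_of_set Int_def del: PiE_dflt_empty_iff)
qed

subsection \<open>Converse\<close>

text \<open>Union bound: if \<open>card S * R > c\<close>, the share of message tuples decoded
  correctly by all of \<open>S\<close> is at most
  \<open>CARD('f) powr (T * (c - card S * R))\<close>, which tends to 0. Since the error
  probabilities also tend to 0, the shares cannot add up to 1.\<close>

lemma achievable_rate_le:
  fixes K n m c :: nat and R :: real
  assumes ach: "achievable TYPE('f::{field,finite}) K n m (\<lambda>_. R)" and S: "S \<subseteq> {..<K}"
    and count: "\<And>T (C :: 'f feedback_code). is_feedback_code K n m T C \<Longrightarrow>
      card {w \<in> PiE_dflt {..<K} 0 (\<lambda>k. {..<msgs C k}). \<forall>k\<in>S. dec C k (outputs K n m C w T k) = w k}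
      \<le> CARD('f) ^ (c * T) * (\<Prod>k\<in>{..<K} - S. msgs C k)"
  shows "card S * R \<le> c"
proof (rule ccontr)
  assume "\<not> card S * R \<le> c"
  then have neg: "real c - real (card S) * R < 0"
    by simp
  define p where "p = CARD('f)"
  have "card {0, 1 :: 'f} \<le> p"
    unfolding p_def by (intro card_mono) auto
  then have p: "p \<ge> 2"
    by simp
  have fin: "finite S"
    using S finite_subset by blast
  obtain C :: "nat \<Rightarrow> 'f feedback_code" where
    code: "\<And>T. T \<ge> 1 \<Longrightarrow> is_feedback_code K n m T (C T)" and
    size: "\<And>T k. T \<ge> 1 \<Longrightarrow> k < K \<Longrightarrow> real (msgs (C T) k) \<ge> p powr (T * R)" and
    err: "\<And>k. k < K \<Longrightarrow> (\<lambda>T. error_prob K n m T (C T) k) \<longlonglongrightarrow> 0"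
    using ach unfolding achievable_def p_def by blast
  have "1 \<le> (p powr (real c - real (card S) * R)) ^ T + (\<Sum>k\<in>S. error_prob K n m T (C T) k)" if T: "T \<ge> 1" for T
  proof -
    define M where "M = msgs (C T)"
    have M: "M k > 0" if "k < K" for k
      using code[OF T] that by (auto simp: is_feedback_code_def M_def)
    define \<Omega> where "\<Omega> = PiE_dflt {..<K} 0 (\<lambda>k. {..<M k})"
    have \<Omega>: "finite \<Omega>" "card \<Omega> = (\<Prod>k<K. M k)"
      unfolding \<Omega>_def by (auto simp: card_PiE_dflt)
    have pos: "(\<Prod>k<K. M k) > 0" "(\<Prod>k\<in>{..<K} - S. M k) > 0" "(\<Prod>k\<in>S. M k) > 0"
      using M S by (auto intro!: prod_pos)
    define bad where "bad k = {w \<in> \<Omega>. dec (C T) k (outputs K n m (C T) w T k) \<noteq> w k}" for k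
    define G where "G = {w \<in> \<Omega>. \<forall>k\<in>S. dec (C T) k (outputs K n m (C T) w T k) = w k}"
    have "\<Omega> \<subseteq> G \<union> (\<Union>k\<in>S. bad k)"
      by (auto simp: G_def bad_def)
    then have "card \<Omega> \<le> card (G \<union> (\<Union>k\<in>S. bad k))"
      using \<Omega> fin by (intro card_mono) (auto simp: G_def bad_def)
    also have "\<dots> \<le> card G + card (\<Union>k\<in>S. bad k)"
      by (rule card_Un_le)
    also have "card (\<Union>k\<in>S. bad k) \<le> (\<Sum>k\<in>S. card (bad k))"
      using fin by (rule card_UN_le)
    finally have "real (card \<Omega>) \<le> card G + (\<Sum>k\<in>S. card (bad k))"
      by (simp flip: of_nat_add of_nat_sum)
    moreover have "card \<Omega> > 0"
      using pos \<Omega> by simp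
    ultimately have "1 \<le> card G / card \<Omega> + (\<Sum>k\<in>S. card (bad k) / card \<Omega>)"
      by (simp add: field_simps flip: sum_divide_distrib)
    also have "(\<Sum>k\<in>S. card (bad k) / card \<Omega>) = (\<Sum>k\<in>S. error_prob K n m T (C T) k)"
      using M by (intro sum.cong refl) (simp add: bad_def \<Omega>(2), simp add: M_def \<Omega>_def error_prob_eq)
    \<comment> \<open>The messages of the users outside \<open>S\<close> cancel between the bound on
      \<open>G\<close> and the number of all tuples.\<close>
    also have "card G / card \<Omega> \<le> p ^ (c * T) / (\<Prod>k\<in>S. M k)"
    proof -
      have "card \<Omega> = (\<Prod>k\<in>S. M k) * (\<Prod>k\<in>{..<K} - S. M k)"
        using S by (simp add: \<Omega> prod.subset_diff mult.commute)
      moreover have "real (card G) \<le> real (p ^ (c * T) * (\<Prod>k\<in>{..<K} - S. M k))"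
        using count[OF code[OF T]] unfolding G_def \<Omega>_def M_def p_def of_nat_le_iff .
      ultimately show ?thesis
        using pos by (simp add: field_simps del: of_nat_prod)
    qed
    also have "\<dots> \<le> p ^ (c * T) / (\<Prod>k\<in>S. p powr (T * R))"
      unfolding of_nat_prod using p S size[OF T] pos(3)
      by (intro divide_left_mono prod_mono mult_pos_pos prod_pos)
        (auto simp: M_def[symmetric] subset_iff intro: M)
    also have "\<dots> = (p powr (real c - real (card S) * R)) ^ T"
      using p by (simp add: powr_realpow[symmetric] powr_powr powr_diff[symmetric] algebra_simps)
    finally show ?thesis by simp
  qed
  moreover have "(\<lambda>T. (p powr (real c - real (card S) * R)) ^ T
      + (\<Sum>k\<in>S. error_prob K n m T (C T) k)) \<longlonglongrightarrow> 0 + (\<Sum>k\<in>S. 0)"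
  proof (intro tendsto_add tendsto_sum err LIMSEQ_realpow_zero)
    show "p powr (real c - real (card S) * R) < 1"
      using powr_less_mono[OF neg, of p] p by simp
  qed (use S in auto)
  ultimately have "1 \<le> (0::real) + (\<Sum>k\<in>S. 0)"
    by (intro LIMSEQ_le_const) auto
  then show False
    by simp
qed

section \<open>Number of vectors over a finite field\<close>

lemma carrier_vec_eq_image: "carrier_vec n = vec_of_list ` {xs. set xs \<subseteq> UNIV \<and> length xs = n}"
proof (intro subset_antisym subsetI)
  fix v :: "'a vec" assume "v \<in> carrier_vec n"
  then show "v \<in> vec_of_list ` {xs. set xs \<subseteq> UNIV \<and> length xs = n}"
    by (intro image_eqI[where x = "list_of_vec v"]) (simp_all add: vec_list)
next
  fix v :: "'a vec" assume "v \<in> vec_of_list ` {xs. set xs \<subseteq> UNIV \<and> length xs = n}"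
  then obtain xs where "v = vec_of_list xs" "length xs = n"
    by blast
  then show "v \<in> carrier_vec n"
    by (intro carrier_vecI) simp
qed

lemma finite_carrier_vec: "finite (carrier_vec n :: 'a::finite vec set)"
  unfolding carrier_vec_eq_image by (intro finite_imageI finite_lists_length_eq finite)

lemma card_carrier_vec: "card (carrier_vec n :: 'a::finite vec set) = CARD('a) ^ n"
proof -
  have "inj_on vec_of_list {xs :: 'a list. set xs \<subseteq> UNIV \<and> length xs = n}"
    by (rule inj_on_inverseI[where g = list_of_vec]) (rule list_vec)
  then show ?thesis
    unfolding carrier_vec_eq_image by (simp only: card_image card_lists_length_eq[OF finite])
qed

section \<open>Counting correctly decoded message tuples\<close>

text \<open>The bound counts an injective description \<open>f\<close> of these tuples: per channel
  use, \<open>max m n\<close> symbols for the output at receiver 0 and \<open>n - m\<close> for the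
  part of input 1 that it cannot see, besides the messages of the other users.\<close>

lemma card_two_users_correct_le:
  fixes C :: "'f::{field,finite} feedback_code"
  assumes K: "K \<ge> 2" and code: "is_feedback_code K n m T C"
  shows "card {w \<in> PiE_dflt {..<K} 0 (\<lambda>k. {..<msgs C k}). \<forall>k\<in>{0,1}. dec C k (outputs K n m C w T k) = w k}
    \<le> CARD('f) ^ ((max m n + (n - m)) * T) * (\<Prod>k\<in>{..<K} - {0,1}. msgs C k)"
    (is "card ?G \<le> _")
proof -
  define e where "e w i t = enc C i t (w i)" for w :: "nat \<Rightarrow> nat" and i t
  define X where "X w t i = e w i t (run K n m (e w) t i)" for w t i
  have outputs: "outputs K n m C w t = run K n m (e w) t" for w t
    by (simp add: outputs_eq_run e_def[abs_def])
  have inside: "w i < msgs C i" if "w \<in> ?G" "i < K" for w i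
    using that by (simp add: PiE_dflt_def)
  have valid: "valid_strategy n m T (e w i)" if "w \<in> ?G" "i < K" for w i
    unfolding e_def by (rule valid_strategy_enc[OF code that(2) inside[OF that]])
  have X: "X w t i \<in> carrier_vec (max m n)" if "w \<in> ?G" "i < K" "t < T" for w t i
    unfolding X_def using valid[OF that(1)] that by (intro run_input_carrier)
  \<comment> \<open>The value 0 at users 0 and 1 is the default of \<open>PiE_dflt\<close>, so that
    \<open>others w\<close> lies in the first factor of \<open>?B\<close>.\<close>
  define others where "others w k = (if k \<in> {..<K} - {0,1} then w k else 0)" for w :: "nat \<Rightarrow> nat" and k
  \<comment> \<open>Interfering entries at levels from \<open>m\<close> on are shifted out at
    receiver 0. For \<open>n \<le> m\<close> there are none and these vectors are empty.\<close>
  define lower where "lower w = map (\<lambda>t. vec (n - m) (\<lambda>j. X w t 1 $ (m + j))) [0..<T]" for w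
  define f where "f w = (others w, run K n m (e w) T 0, lower w)" for w
  define lists :: "nat \<Rightarrow> 'f vec list set" where
    "lists l = {xs. set xs \<subseteq> carrier_vec l \<and> length xs = T}" for l
  have card_lists: "finite (lists l)" "card (lists l) = CARD('f) ^ (l * T)" for l
    unfolding lists_def
    by (simp_all add: finite_lists_length_eq card_lists_length_eq finite_carrier_vec card_carrier_vec power_mult)
  let ?B = "PiE_dflt ({..<K} - {0,1}) 0 (\<lambda>k. {..<msgs C k}) \<times> lists (max m n) \<times> lists (n - m)"
  have "inj_on f ?G"
  proof (rule inj_onI)
    fix w w' assume w: "w \<in> ?G" and w': "w' \<in> ?G" and f: "f w = f w'"
    have Y0: "run K n m (e w) T 0 = run K n m (e w') T 0"
      using f by (simp add: f_def)
    have dec: "dec C k (run K n m (e v) T k) = v k" if "v \<in> ?G" "k \<in> {0,1}" for v k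
      using that unfolding outputs by blast
    have outside: "v k = 0" if "v \<in> ?G" "\<not> k < K" for v k
      using that by (simp add: PiE_dflt_def)
    have "w 0 = w' 0"
      using dec[OF w, of 0] dec[OF w', of 0] Y0 by simp
    have eq: "w k = w' k" if "k \<noteq> 1" for k
    proof (cases "k \<in> {..<K} - {0,1}")
      case True
      moreover have "others w k = others w' k"
        using f by (simp add: f_def)
      ultimately show ?thesis
        by (simp add: others_def)
    next
      case False
      then show ?thesis
        using \<open>w 0 = w' 0\<close> that outside[OF w] outside[OF w'] by (cases "k = 0") auto
    qed
    \<comment> \<open>The message of user 1 is still unknown here, so its input is recovered from
      output 0 and \<open>lower\<close>; all other inputs follow from equal messages and equal past
      outputs.\<close>
    have "run K n m (e w) t = run K n m (e w') t" if "t \<le> T" for t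
      using that
    proof (induction t)
      case (Suc t)
      have t: "t < T" and IH: "run K n m (e w) t = run K n m (e w') t"
        using Suc by simp_all
      have X_eq: "X w t i = X w' t i" if "i \<noteq> 1" for i
        unfolding X_def IH by (simp add: e_def eq[OF that])
      have "X w t 1 = X w' t 1"
      proof (rule eq_vecI)
        have dims: "X w t 1 \<in> carrier_vec (max m n)" "X w' t 1 \<in> carrier_vec (max m n)"
          using K t by (simp_all add: X[OF w] X[OF w'])
        then show "dim_vec (X w t 1) = dim_vec (X w' t 1)"
          by auto
        fix j assume "j < dim_vec (X w' t 1)"
        then have j: "j < max m n"
          using dims by auto
        show "X w t 1 $ j = X w' t 1 $ j"
        proof (cases "j < m")
          case True
          \<comment> \<open>Entry \<open>j\<close> of an interfering input arrives at this level,
            where all other terms already agree.\<close>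
          let ?j = "j + (max m n - m)"
          have split: "{..<K} - {0} = insert 1 ({..<K} - {0,1})"
            using K by auto
          have "channel_output K n m (X w t) 0 = channel_output K n m (X w' t) 0"
            using nth_run[of t T K n m "e w" 0] nth_run[of t T K n m "e w'" 0] Y0 t
            by (simp add: X_def[abs_def])
          then have "channel_output K n m (X w t) 0 $ ?j = channel_output K n m (X w' t) 0 $ ?j"
            by simp
          moreover have "?j < max m n" "?j - (max m n - m) = j" "max m n - m \<le> ?j"
            using True by auto
          ultimately show ?thesis
            using K t by (simp add: channel_output_index split X[OF w] X[OF w'] X_eq cong: if_cong)
        next
          case False
          have "lower w ! t = lower w' ! t"
            using f by (simp add: f_def)
          then have "vec (n - m) (\<lambda>j. X w t 1 $ (m + j)) $ (j - m) = vec (n - m) (\<lambda>j. X w' t 1 $ (m + j)) $ (j - m)"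
            using t by (simp add: lower_def)
          moreover have "j - m < n - m" "m + (j - m) = j"
            using False j by linarith+
          ultimately show ?thesis
            by simp
        qed
      qed
      then have "X w t = X w' t"
        using X_eq by (intro ext) metis
      then show ?case
        using IH by (simp add: X_def[abs_def])
    qed simp
    then have "w 1 = w' 1"
      using dec[OF w, of 1] dec[OF w', of 1] by simp
    then show "w = w'"
      using eq by (intro ext) metis
  qed
  moreover have "f ` ?G \<subseteq> ?B"
  proof (rule image_subsetI)
    fix w assume w: "w \<in> ?G"
    have "others w \<in> PiE_dflt ({..<K} - {0,1}) 0 (\<lambda>k. {..<msgs C k})"
      using inside[OF w] by (simp add: others_def PiE_dflt_def)
    moreover have "run K n m (e w) T 0 \<in> lists (max m n)"
      unfolding lists_def using run_carrier[where t = T and k = 0, OF valid[OF w]] K by simp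
    moreover have "lower w \<in> lists (n - m)"
      by (auto simp: lists_def lower_def)
    ultimately show "f w \<in> ?B"
      by (simp add: f_def)
  qed
  moreover have "finite ?B"
    by (intro finite_cartesian_product finite_PiE_dflt card_lists) auto
  ultimately have "card ?G \<le> card ?B"
    by (rule card_inj_on_le)
  also have "\<dots> = CARD('f) ^ ((max m n + (n - m)) * T) * (\<Prod>k\<in>{..<K} - {0,1}. msgs C k)"
    by (simp add: card_cartesian_product card_lists card_PiE_dflt power_add add_mult_distrib)
  finally show ?thesis .
qed

text \<open>The common output sequence alone determines every correctly decoded message, so the
  tuples inject into the output sequences.\<close>

lemma card_all_users_correct_le:
  fixes C :: "'f::{field,finite} feedback_code"
  assumes K: "K > 0" and code: "is_feedback_code K n n T C"
  shows "card {w \<in> PiE_dflt {..<K} 0 (\<lambda>k. {..<msgs C k}). \<forall>k\<in>{..<K}. dec C k (outputs K n n C w T k) = w k}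
    \<le> CARD('f) ^ (n * T)"
    (is "card ?G \<le> _")
proof -
  define e where "e w i t = enc C i t (w i)" for w :: "nat \<Rightarrow> nat" and i t
  have outputs: "outputs K n n C w t = run K n n (e w) t" for w t
    by (simp add: outputs_eq_run e_def[abs_def])
  have valid: "valid_strategy n n T (e w i)" if "w \<in> ?G" "i < K" for w i
    unfolding e_def using that by (intro valid_strategy_enc[OF code that(2)]) (simp add: PiE_dflt_def)
  have same: "run K n n (e w) T k = run K n n (e w) T 0" if w: "w \<in> ?G" and k: "k < K" for w k
  proof (rule nth_equalityI)
    fix t assume "t < length (run K n n (e w) T k)"
    then show "run K n n (e w) T k ! t = run K n n (e w) T 0 ! t"
      using K k run_input_carrier[of K n n T "e w" t, OF valid[OF w]]
      by (simp add: nth_run) (intro channel_output_equal_gains; simp)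
  qed simp
  let ?B = "{xs. set xs \<subseteq> (carrier_vec n :: 'f vec set) \<and> length xs = T}"
  have "inj_on (\<lambda>w. run K n n (e w) T 0) ?G"
  proof (rule inj_onI)
    fix w w' assume w: "w \<in> ?G" "w' \<in> ?G" and eq: "run K n n (e w) T 0 = run K n n (e w') T 0"
    show "w = w'"
    proof
      fix k
      show "w k = w' k"
      proof (cases "k < K")
        case True
        then have "run K n n (e w) T k = run K n n (e w') T k"
          using same[OF w(1) True] same[OF w(2) True] eq by simp
        then show ?thesis
          using w True unfolding outputs by (metis (mono_tags, lifting) lessThan_iff mem_Collect_eq)
      qed (use w in \<open>simp add: PiE_dflt_def\<close>)
    qed
  qed
  moreover have "(\<lambda>w. run K n n (e w) T 0) ` ?G \<subseteq> ?B"
  proof (rule image_subsetI)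
    fix w assume w: "w \<in> ?G"
    show "run K n n (e w) T 0 \<in> ?B"
      using run_carrier[where t = T and k = 0, OF valid[OF w]] K by simp
  qed
  moreover have "finite ?B"
    using finite_carrier_vec by (rule finite_lists_length_eq)
  ultimately have "card ?G \<le> card ?B"
    by (rule card_inj_on_le)
  then show ?thesis
    by (simp add: card_lists_length_eq finite_carrier_vec card_carrier_vec power_mult)
qed

subsection \<open>Achievability\<close>

text \<open>The channel is memoryless, so strategies that forget all outputs before the current
  block behave in block \<open>b\<close> like a fresh run.\<close>

lemma drop_run_blocks:
  assumes "L > 0" "s \<le> L"
  shows "drop (L * b) (run K n m (\<lambda>i t ys. e (t div L) i (t mod L) (drop (L * (t div L)) ys)) (L * b + s) k)
    = run K n m (e b) s k"
  using assms(2)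
proof (induction s arbitrary: k)
  case (Suc s)
  then have "(L * b + s) div L = b" "(L * b + s) mod L = s"
    by auto
  then show ?case
    using Suc by simp
qed simp

text \<open>Base-\<open>M\<close> expansion, used to send one digit of a message per block; the
  induction strips the lowest digit.\<close>

lemma eq_if_digits_eq:
  fixes x y M :: nat
  assumes "\<And>b. b < B \<Longrightarrow> x div M ^ b mod M = y div M ^ b mod M" "x < M ^ B" "y < M ^ B"
  shows "x = y"
  using assms
proof (induction B arbitrary: x y)
  case (Suc B)
  have "x mod M = y mod M"
    using Suc.prems(1)[of 0] by simp
  moreover have "x div M = y div M"
  proof (rule Suc.IH)
    show "x div M div M ^ b mod M = y div M div M ^ b mod M" if "b < B" for b
      using Suc.prems(1)[of "Suc b"] that by (simp add: div_mult2_eq)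
  qed (use Suc.prems in \<open>simp_all add: less_mult_imp_div_less mult.commute\<close>)
  ultimately show ?case
    by (metis div_mult_mod_eq)
qed simp

text \<open>With \<open>M = CARD('f) ^ N\<close>, a message below \<open>M ^ (T div L)\<close> is
  sent as \<open>T div L\<close> digits, one per block. The loss from the incomplete last block is
  absorbed by \<open>R < N / L\<close> for large \<open>T\<close>.\<close>

lemma achievable_if_zero_error_block:
  fixes e :: "nat \<Rightarrow> 'a \<Rightarrow> nat \<Rightarrow> 'f::{field,finite} vec list \<Rightarrow> 'f vec"
  assumes L: "L > 0" and A: "finite A" "card A = CARD('f) ^ N"
    and valid: "\<And>i a. i < K \<Longrightarrow> a \<in> A \<Longrightarrow> valid_strategy n m L (e i a)"
    and zero_error: "\<And>a b k. \<lbrakk>\<And>i. i < K \<Longrightarrow> a i \<in> A; \<And>i. i < K \<Longrightarrow> b i \<in> A; k < K;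
      run K n m (\<lambda>i. e i (a i)) L k = run K n m (\<lambda>i. e i (b i)) L k\<rbrakk> \<Longrightarrow> a k = b k"
    and R: "R < N / L"
  shows "achievable TYPE('f) K n m (\<lambda>_. R)"
proof -
  define p where "p = CARD('f)"
  have "card {0, 1 :: 'f} \<le> p"
    unfolding p_def by (intro card_mono) auto
  then have p: "p \<ge> 2"
    by simp
  define M where "M = p ^ N"
  have M: "M > 0"
    using p by (simp add: M_def)
  obtain g where g: "bij_betw g {..<M} A"
    using A ex_bij_betw_nat_finite[of A] by (auto simp: M_def p_def atLeast0LessThan)
  define digit where "digit x b = x div M ^ b mod M" for x b
  have g_digit: "g (digit x b) \<in> A" for x b
    using g M by (auto simp: digit_def bij_betw_def)
  define E where "E w i t ys = e i (g (digit (w i) (t div L))) (t mod L) (drop (L * (t div L)) ys)"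
    for w :: "nat \<Rightarrow> nat" and i t ys
  define \<Omega> where "\<Omega> T = PiE_dflt {..<K} 0 (\<lambda>k. {..<M ^ (T div L)})" for T
  \<comment> \<open>\<open>E\<close> reads only the own entry of the tuple, hence the constant tuple
    in \<open>enc\<close>. The decoder takes the own message from any tuple consistent with the
    output; zero error makes it unique.\<close>
  define good where "good T = \<lparr>msgs = \<lambda>_. M ^ (T div L),
      enc = \<lambda>i t w. E (\<lambda>_. w) i t,
      dec = \<lambda>k ys. SOME x. \<exists>w\<in>\<Omega> T. run K n m (E w) T k = ys \<and> w k = x\<rparr>" for T
  \<comment> \<open>For small \<open>T\<close> the block code may be too small. Any code with enough
    messages serves there, since finitely many lengths do not affect the limit of the
    errors.\<close>
  define trivial :: "nat \<Rightarrow> 'f feedback_code" where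
    "trivial T = \<lparr>msgs = \<lambda>_. Suc (nat \<lceil>real p powr (T * R)\<rceil>),
      enc = \<lambda>_ _ _ _. 0\<^sub>v (max m n), dec = \<lambda>_ _. 0\<rparr>" for T
  define C where "C T = (if p powr (T * R) \<le> M ^ (T div L) then good T else trivial T)" for T

  have "is_feedback_code K n m T (good T)" for T
    unfolding is_feedback_code_def
  proof (intro allI impI conjI)
    fix k t w and ys :: "'f vec list"
    assume k: "k < K" "t < T" "length ys = t \<and> set ys \<subseteq> carrier_vec (max m n)"
    have "length (drop (L * (t div L)) ys) = t mod L"
      using k by (simp add: minus_mult_div_eq_mod)
    moreover have "set (drop (L * (t div L)) ys) \<subseteq> carrier_vec (max m n)"
      using k set_drop_subset by fastforce
    ultimately show "enc (good T) k t w ys \<in> carrier_vec (max m n)"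
      using valid[OF k(1) g_digit, of w "t div L"] L by (simp add: good_def E_def valid_strategy_def)
  qed (use M in \<open>simp_all add: good_def\<close>)
  moreover have "is_feedback_code K n m T (trivial T)" for T
    by (simp add: is_feedback_code_def trivial_def)
  ultimately have code: "is_feedback_code K n m T (C T)" for T
    by (simp add: C_def)

  have "real (msgs (trivial T) k) \<ge> p powr (T * R)" for T k
    by (simp add: trivial_def) linarith
  then have size: "real (msgs (C T) k) \<ge> p powr (T * R)" for T k
    by (simp add: C_def good_def)

  have good_error: "error_prob K n m T (good T) k = 0" if k: "k < K" for T k
  proof -
    have msgs: "msgs (good T) i > 0" for i
      using M by (simp add: good_def)
    have out: "outputs K n m (good T) w T k = run K n m (E w) T k" for w
      by (simp add: outputs_eq_run good_def E_def[abs_def])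
    have "dec (good T) k (run K n m (E w) T k) = w k" if w: "w \<in> \<Omega> T" for w
    proof -
      define x where "x = dec (good T) k (run K n m (E w) T k)"
      have "\<exists>w'\<in>\<Omega> T. run K n m (E w') T k = run K n m (E w) T k \<and> w' k = x"
        unfolding x_def good_def feedback_code.simps
        by (rule someI_ex[of "\<lambda>x. \<exists>w'\<in>\<Omega> T. run K n m (E w') T k = run K n m (E w) T k \<and> w' k = x"])
          (use w in blast)
      then obtain w' where w': "w' \<in> \<Omega> T" "run K n m (E w') T k = run K n m (E w) T k" "w' k = x"
        by blast
      have "w' k = w k"
      proof (rule eq_if_digits_eq)
        fix b assume b: "b < T div L"
        have "L * b + L \<le> L * (T div L)"
          using b by (metis Suc_leI mult_Suc_right mult_le_mono2 add.commute)
        also have "\<dots> \<le> T"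
          by simp
        finally have "L * b + L \<le> T" .
        then have "run K n m (E w') (L * b + L) k = run K n m (E w) (L * b + L) k"
          using w'(2) by (metis take_run)
        then have "run K n m (\<lambda>i. e i (g (digit (w' i) b))) L k = run K n m (\<lambda>i. e i (g (digit (w i) b))) L k"
          using drop_run_blocks[OF L order_refl, of b K n m "\<lambda>b i. e i (g (digit (w' i) b))" k]
            drop_run_blocks[OF L order_refl, of b K n m "\<lambda>b i. e i (g (digit (w i) b))" k]
          by (simp add: E_def[abs_def])
        then have "g (digit (w' k) b) = g (digit (w k) b)"
          using zero_error[of "\<lambda>i. g (digit (w' i) b)" "\<lambda>i. g (digit (w i) b)" k] g_digit k by blast
        moreover have "digit (w' k) b < M" "digit (w k) b < M"
          using M by (simp_all add: digit_def)
        ultimately have "digit (w' k) b = digit (w k) b"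
          using g by (meson bij_betw_def inj_onD lessThan_iff)
        then show "w' k div M ^ b mod M = w k div M ^ b mod M"
          by (simp add: digit_def)
      qed (use w w' k in \<open>auto simp: \<Omega>_def PiE_dflt_def\<close>)
      then show ?thesis
        using w' by (simp add: x_def)
    qed
    then have no_error: "{w \<in> PiE_dflt {..<K} 0 (\<lambda>k. {..<msgs (good T) k}).
        dec (good T) k (outputs K n m (good T) w T k) \<noteq> w k} = {}"
      unfolding out by (auto simp: \<Omega>_def good_def)
    show ?thesis
      unfolding error_prob_eq[OF msgs] no_error by simp
  qed

  \<comment> \<open>The threshold solves \<open>T * R \<le> N * (T / L - 1)\<close> for
    \<open>T\<close>, and \<open>T / L - 1\<close> bounds \<open>T div L\<close> from below.\<close>
  have "eventually (\<lambda>T. p powr (T * R) \<le> M ^ (T div L)) sequentially"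
    using eventually_ge_at_top[of "nat \<lceil>N / (N / L - R)\<rceil>"]
  proof eventually_elim
    case (elim T)
    then have "N / (N / L - R) \<le> T"
      by linarith
    then have "T * R \<le> N * (T / L - 1)"
      using R by (simp add: field_simps)
    also have "N * (T / L - 1) \<le> N * real (T div L)"
    proof (rule mult_left_mono)
      have "real T < real (L + T div L * L)"
        using dividend_less_div_times[OF L, of T] by (simp only: of_nat_less_iff)
      then show "T / L - 1 \<le> real (T div L)"
        using L by (simp add: field_simps)
    qed simp
    finally have "T * R \<le> real (N * (T div L))"
      by simp
    then have "p powr (T * R) \<le> p powr real (N * (T div L))"
      using p by (intro powr_mono) auto
    also have "\<dots> = M ^ (T div L)"
      using p by (subst powr_realpow) (auto simp: M_def power_mult)
    finally show ?case .
  qed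
  then have "eventually (\<lambda>T. error_prob K n m T (C T) k = 0) sequentially" if "k < K" for k
    by eventually_elim (simp add: C_def good_error[OF that])
  then have "(\<lambda>T. error_prob K n m T (C T) k) \<longlonglongrightarrow> 0" if "k < K" for k
    using that by (intro tendsto_eventually) auto
  then show ?thesis
    using code size unfolding achievable_def p_def by blast
qed

section \<open>Block schemes for the three regimes\<close>

text \<open>Time division: a block has one channel use per user, and at channel use \<open>k\<close>
  only user \<open>k\<close> is active.\<close>

lemma achievable_equal_gains:
  assumes K: "K > 0" and R: "R < n / K"
  shows "achievable TYPE('f::{field,finite}) K n n (\<lambda>_. R)"
proof (rule achievable_if_zero_error_block[OF K finite_carrier_vec card_carrier_vec _ _ R])
  define e :: "nat \<Rightarrow> 'f vec \<Rightarrow> nat \<Rightarrow> 'f vec list \<Rightarrow> 'f vec"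
    where "e i x t ys = (if t = i then x else 0\<^sub>v n)" for i x t ys
  show valid: "valid_strategy n n K (e i x)" if "x \<in> carrier_vec n" for i x
    using that by (simp add: valid_strategy_def e_def)
  fix a b :: "nat \<Rightarrow> 'f vec" and k
  assume a: "\<And>i. i < K \<Longrightarrow> a i \<in> carrier_vec n" and b: "\<And>i. i < K \<Longrightarrow> b i \<in> carrier_vec n"
    and k: "k < K" and eq: "run K n n (\<lambda>i. e i (a i)) K k = run K n n (\<lambda>i. e i (b i)) K k"
  have out: "(run K n n (\<lambda>i. e i (a i)) K k ! k) $ j = a k $ j"
    if "\<And>i. i < K \<Longrightarrow> a i \<in> carrier_vec n" "j < n" for a j
  proof -
    have "e i (a i) k (run K n n (\<lambda>i. e i (a i)) k i) \<in> carrier_vec n" if "i < K" for i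
      using \<open>\<And>i. i < K \<Longrightarrow> a i \<in> carrier_vec n\<close>[OF that] by (simp add: e_def)
    then have "(run K n n (\<lambda>i. e i (a i)) K k ! k) $ j = (\<Sum>i<K. e i (a i) k (run K n n (\<lambda>i. e i (a i)) k i) $ j)"
      using k that by (subst nth_run) (auto simp: channel_output_index_total)
    also have "\<dots> = (\<Sum>i<K. if k = i then a k $ j else 0)"
      using that by (intro sum.cong) (auto simp: e_def)
    finally show ?thesis
      using k by simp
  qed
  show "a k = b k"
  proof (rule eq_vecI)
    show "dim_vec (a k) = dim_vec (b k)"
      using a[OF k] b[OF k] by auto
    show "a k $ j = b k $ j" if "j < dim_vec (b k)" for j
    proof -
      have "j < n"
        using that b[OF k] by auto
      then show ?thesis
        using out[where a = a, OF a] out[where a = b, OF b] eq by simp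
    qed
  qed
qed

text \<open>
  With \<open>S\<close> the sum of all inputs of the first channel use, every transmitter learns \<open>S\<close> on the
  \<open>m\<close> upper levels from its own output.  In the second channel use all transmitters repeat \<open>S\<close>
  on these levels, so that the interference at each level is a multiple of an entry of \<open>S\<close> that
  the receiver has seen without interference or decoded at a higher level.
\<close>

lemma achievable_strong_direct_link:
  assumes nm: "m < n" and R: "R < n - m / 2"
  shows "achievable TYPE('f::{field,finite}) K n m (\<lambda>_. R)"
proof (rule achievable_if_zero_error_block)
  \<comment> \<open>The first component is the first input; the second holds \<open>n - m\<close>
    fresh symbols for the levels from \<open>m\<close> on in the second channel use.\<close>
  let ?A = "carrier_vec n \<times> carrier_vec (n - m) :: ('f vec \<times> 'f vec) set"
  show "finite ?A"
    using finite_carrier_vec by auto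
  show "card ?A = CARD('f) ^ (2 * n - m)"
    using nm by (simp add: card_cartesian_product card_carrier_vec mult_2 flip: power_add)
  show "(2::nat) > 0" "R < real (2 * n - m) / real 2"
    using R nm by (simp_all add: field_simps)
  \<comment> \<open>For \<open>j < m\<close> the output at level \<open>j + (n - m)\<close> is
    turned into the sum of all entries at \<open>j\<close>: the own direct entry is removed and the
    own entry at \<open>j\<close>, absent from the interference, is added.\<close>
  define e :: "nat \<Rightarrow> 'f vec \<times> 'f vec \<Rightarrow> nat \<Rightarrow> 'f vec list \<Rightarrow> 'f vec"
    where "e i xu t ys = (if t = 0 then fst xu else vec n (\<lambda>j.
      if j < m then (ys ! 0) $ (j + (n - m)) - fst xu $ (j + (n - m)) + fst xu $ j
      else snd xu $ (j - m)))" for i xu t ys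
  have e_carrier: "e i xu t ys \<in> carrier_vec n" if "xu \<in> ?A" for i xu t ys
    using that by (auto simp: e_def)
  then show "valid_strategy n m 2 (e i xu)" if "xu \<in> ?A" for i xu
    using nm that by (simp add: valid_strategy_def max_def)
  define y where "y a t k = run K n m (\<lambda>i. e i (a i)) 2 k ! t" for a t k
  define S where "S a j = (\<Sum>i<K. fst (a i) $ j)" for a :: "nat \<Rightarrow> 'f vec \<times> 'f vec" and j
  \<comment> \<open>Closed form, without feedback, of the input of user \<open>k\<close> in the
    second channel use.\<close>
  define z where "z a k j = (if j < m then S a j else snd (a k) $ (j - m))"
    for a :: "nat \<Rightarrow> 'f vec \<times> 'f vec" and k j
  have y0: "y a 0 k $ j = fst (a k) $ j + (if n - m \<le> j then S a (j - (n - m)) - fst (a k) $ (j - (n - m)) else 0)"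
    if a: "\<And>i. i < K \<Longrightarrow> a i \<in> ?A" and k: "k < K" and j: "j < n" for a k j
  proof -
    have "y a 0 k = channel_output K n m (\<lambda>i. fst (a i)) k"
      by (simp add: y_def nth_run e_def)
    moreover have "fst (a i) \<in> carrier_vec n" if "i < K" for i
      using a[OF that] by auto
    ultimately show ?thesis
      using channel_output_direct[OF nm, where X = "\<lambda>i. fst (a i)" and K = K and k = k and j = j] k j
      by (simp add: S_def)
  qed
  have y1: "y a 1 k $ j = z a k j + (if n - m \<le> j then of_nat K * S a (j - (n - m)) - S a (j - (n - m)) else 0)"
    if a: "\<And>i. i < K \<Longrightarrow> a i \<in> ?A" and k: "k < K" and j: "j < n" for a k j
  proof -
    define X where "X i = e i (a i) 1 (run K n m (\<lambda>i. e i (a i)) 1 i)" for i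
    have X: "X i $ j = z a i j" if "i < K" "j < n" for i j
    proof -
      have "run K n m (\<lambda>i. e i (a i)) 1 i ! 0 = y a 0 i"
        unfolding y_def by (rule nth_run_mono) auto
      moreover have "y a 0 i $ l = fst (a i) $ l + (S a j - fst (a i) $ j)" if "l = j + (n - m)" "l < n" for l
        using y0[where a = a and k = i and j = l, OF a] that \<open>i < K\<close> by simp
      ultimately show ?thesis
        using that nm by (simp add: X_def e_def z_def less_diff_conv)
    qed
    have "X i \<in> carrier_vec n" if "i < K" for i
      using e_carrier[OF a[OF that]] by (simp add: X_def)
    then have "channel_output K n m X k $ j
        = X k $ j + (if n - m \<le> j then (\<Sum>i<K. X i $ (j - (n - m))) - X k $ (j - (n - m)) else 0)"
      using k j by (intro channel_output_direct[OF nm])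
    moreover have "y a 1 k = channel_output K n m X k"
      unfolding y_def X_def[abs_def] by (rule nth_run) simp
    moreover have "X i $ (j - (n - m)) = S a (j - (n - m))" if "i < K" "n - m \<le> j" for i
    proof -
      have "j - (n - m) < m" "j - (n - m) < n"
        using that j nm by linarith+
      then show ?thesis
        using X[OF that(1)] by (simp add: z_def)
    qed
    ultimately show ?thesis
      using k X[OF k j] by simp
  qed
  fix a b k
  assume a: "\<And>i. i < K \<Longrightarrow> a i \<in> ?A" and b: "\<And>i. i < K \<Longrightarrow> b i \<in> ?A" and k: "k < K"
    and eq: "run K n m (\<lambda>i. e i (a i)) 2 k = run K n m (\<lambda>i. e i (b i)) 2 k"
  have y_eq: "y a t k = y b t k" for t
    using eq by (simp add: y_def)
  have lower: "j - (n - m) < j" "j - (n - m) < m" "j - (n - m) < n" if "n - m \<le> j" "j < n" for j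
    using that nm by linarith+
  \<comment> \<open>By increasing level: the interference at \<open>j\<close> is
    \<open>K - 1\<close> times \<open>S\<close> at \<open>j - (n - m) < m\<close>, which is the
    entry of \<open>z\<close> there. The factor may vanish in the field without harm.\<close>
  have z: "z a k j = z b k j" if "j < n" for j
    using that
  proof (induction j rule: less_induct)
    case (less j)
    have "S a (j - (n - m)) = S b (j - (n - m))" if "n - m \<le> j"
      using less.IH[of "j - (n - m)"] lower[OF that less.prems] by (simp add: z_def)
    then show ?case
      using y1[where a = a, OF a k less.prems] y1[where a = b, OF b k less.prems] y_eq[of 1] by (simp split: if_splits)
  qed
  \<comment> \<open>With \<open>S\<close> known, the first output is solved for the own input in the
    same order of levels.\<close>
  have x: "fst (a k) $ j = fst (b k) $ j" if "j < n" for j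
    using that
  proof (induction j rule: less_induct)
    case (less j)
    have "S a (j - (n - m)) = S b (j - (n - m))" if "n - m \<le> j"
      using z[of "j - (n - m)"] lower[OF that less.prems] by (simp add: z_def)
    moreover have "fst (a k) $ (j - (n - m)) = fst (b k) $ (j - (n - m))" if "n - m \<le> j"
      using less.IH lower[OF that less.prems] by simp
    ultimately show ?case
      using y0[where a = a, OF a k less.prems] y0[where a = b, OF b k less.prems] y_eq[of 0] by (simp split: if_splits)
  qed
  have u: "snd (a k) $ j = snd (b k) $ j" if "j < n - m" for j
    using z[of "j + m"] that by (simp add: z_def)
  show "a k = b k"
    using x u a[OF k] b[OF k] by (intro prod_eqI eq_vecI) auto
qed

text \<open>
  For \<open>n < m\<close> every transmitter learns the sums \<open>S 0\<close> and \<open>S 1\<close> of all inputs of the first two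
  channel uses.  Letting every transmitter repeat them would deliver them with the factor \<open>K - 1\<close>,
  which may vanish in the field.  Instead only the users \<open>0\<close> and \<open>1\<close> transmit, namely \<open>S 0, S 1\<close>
  and \<open>S 1, S 0 + S 1\<close>: the matrices \<open>I\<close>, \<open>((0, 1), (1, 1))\<close> and their sum are invertible over
  every field, and the direct links only contribute a nilpotent perturbation.
\<close>

lemma achievable_strong_cross_links:
  assumes K: "K \<ge> 2" and nm: "n < m" and R: "R < m / 2"
  shows "achievable TYPE('f::{field,finite}) K n m (\<lambda>_. R)"
proof (rule achievable_if_zero_error_block)
  \<comment> \<open>Each user sends two fresh vectors in the first two of four channel uses, hence
    \<open>2 * m\<close> symbols per block.\<close>
  let ?A = "carrier_vec m \<times> carrier_vec m :: ('f vec \<times> 'f vec) set"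
  show "finite ?A"
    using finite_carrier_vec by auto
  show "card ?A = CARD('f) ^ (2 * m)"
    by (simp add: card_cartesian_product card_carrier_vec mult_2 flip: power_add)
  show "(4::nat) > 0" "R < real (2 * m) / real 4"
    using R by simp_all
  define d where "d = m - n"
  have d: "d > 0" "max m n - n = d" "max m n = m"
    using nm by (simp_all add: d_def)
  define sel where "sel r x = (if r = 0 then fst x else snd x)" for r :: nat and x :: "'f vec \<times> 'f vec"
  \<comment> \<open>Adding the own entry and removing the direct contribution turns the own output
    into the sum of all inputs.\<close>
  define sumv where "sumv r xx ys = vec m (\<lambda>j. (ys ! r) $ j + sel r xx $ j - (if d \<le> j then sel r xx $ (j - d) else 0))"
    for r xx and ys :: "'f vec list"
  define e :: "nat \<Rightarrow> 'f vec \<times> 'f vec \<Rightarrow> nat \<Rightarrow> 'f vec list \<Rightarrow> 'f vec"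
    where "e i xx t ys =
      (if t < 2 then sel t xx
       else if i = 0 then sumv (t - 2) xx ys
       else if i = 1 then (if t = 2 then sumv 1 xx ys else sumv 0 xx ys + sumv 1 xx ys)
       else 0\<^sub>v m)" for i xx t ys
  have sumv_carrier: "sumv r xx ys \<in> carrier_vec m" for r xx ys
    by (simp add: sumv_def)
  have e_carrier: "e i xx t ys \<in> carrier_vec m" if "xx \<in> ?A" for i xx t ys
    using that sumv_carrier by (auto simp: e_def sel_def)
  then show "valid_strategy n m 4 (e i xx)" if "xx \<in> ?A" for i xx
    using that d by (simp add: valid_strategy_def)
  define y where "y a t k = run K n m (\<lambda>i. e i (a i)) 4 k ! t" for a t k
  define S where "S r a j = (\<Sum>i<K. sel r (a i) $ j)" for r a j
  define X where "X a t i = e i (a i) t (run K n m (\<lambda>i. e i (a i)) t i)" for a t i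
  have y: "y a t k $ j = (if d \<le> j then X a t k $ (j - d) else 0) + ((\<Sum>i<K. X a t i $ j) - X a t k $ j)"
    if a: "\<And>i. i < K \<Longrightarrow> a i \<in> ?A" and "t < 4" "k < K" "j < m" for a t k j
  proof -
    have "X a t i \<in> carrier_vec m" if "i < K" for i
      unfolding X_def using e_carrier[OF a[OF that]] .
    moreover have "y a t k = channel_output K n m (X a t) k"
      using \<open>t < 4\<close> by (simp add: y_def nth_run X_def[abs_def])
    ultimately show ?thesis
      using channel_output_cross[OF nm, of K "X a t"] that by (simp add: d_def)
  qed
  have y01: "y a t k $ j = (if d \<le> j then sel t (a k) $ (j - d) else 0) + (S t a j - sel t (a k) $ j)"
    if "\<And>i. i < K \<Longrightarrow> a i \<in> ?A" "t < 2" "k < K" "j < m" for a t k j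
    using y[of a t k j] that by (simp add: X_def e_def S_def)
  have sumv: "sumv r (a i) (run K n m (\<lambda>i. e i (a i)) t i) $ j = S r a j"
    if a: "\<And>i. i < K \<Longrightarrow> a i \<in> ?A" and "i < K" "j < m" "2 \<le> t" "t \<le> 4" "r < 2" for a i j t r
  proof -
    have "run K n m (\<lambda>i. e i (a i)) t i ! r = y a r i"
      unfolding y_def using that by (intro nth_run_mono) auto
    then show ?thesis
      using that y01[where a = a and t = r and k = i and j = j, OF a] by (simp add: sumv_def)
  qed
  \<comment> \<open>Closed form of the inputs in channel uses 2 and 3; \<open>S (t - 2)\<close> is
    \<open>S 0\<close> and then \<open>S 1\<close>.\<close>
  define c where "c a t i j = (if i = 0 then S (t - 2) a j
      else if i = 1 then (if t = 2 then S 1 a j else S 0 a j + S 1 a j) else 0)" for a t and i j :: nat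
  have X: "X a t i $ j = c a t i j"
    if a: "\<And>i. i < K \<Longrightarrow> a i \<in> ?A" and "i < K" "j < m" "2 \<le> t" "t < 4" for a t i j
    using sumv[where a = a, OF a] that carrier_vecD[OF sumv_carrier] by (auto simp: X_def e_def c_def)
  have y23: "y a t k $ j = (if d \<le> j then c a t k (j - d) else 0) + (c a t 0 j + c a t 1 j - c a t k j)"
    if a: "\<And>i. i < K \<Longrightarrow> a i \<in> ?A" and "2 \<le> t" "t < 4" "k < K" "j < m" for a t k j
  proof -
    have "(\<Sum>i<K. X a t i $ j) = (\<Sum>i<K. c a t i j)"
      using X[where a = a, OF a] that by (intro sum.cong) auto
    also have "\<dots> = (\<Sum>i\<in>{0,1}. c a t i j)"
      using K by (intro sum.mono_neutral_right) (auto simp: c_def)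
    finally show ?thesis
      using y[where a = a, OF a] X[where a = a, OF a] that by simp
  qed
  fix a b k
  assume a: "\<And>i. i < K \<Longrightarrow> a i \<in> ?A" and b: "\<And>i. i < K \<Longrightarrow> b i \<in> ?A" and k: "k < K"
    and eq: "run K n m (\<lambda>i. e i (a i)) 4 k = run K n m (\<lambda>i. e i (b i)) 4 k"
  have y_eq: "y a t k = y b t k" for t
    using eq by (simp add: y_def)
  \<comment> \<open>By increasing level: the direct link only contributes entries from level
    \<open>j - d\<close>, and \<open>d > 0\<close>.\<close>
  have S: "S 0 a j = S 0 b j \<and> S 1 a j = S 1 b j" if "j < m" for j
    using that
  proof (induction j rule: less_induct)
    case (less j)
    have "S 0 a (j - d) = S 0 b (j - d) \<and> S 1 a (j - d) = S 1 b (j - d)" if "d \<le> j"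
      using less that d by simp
    then have prev: "(if d \<le> j then c a t k (j - d) else 0) = (if d \<le> j then c b t k (j - d) else 0)"
      if "t = 2 \<or> t = 3" for t
      using that by (auto simp: c_def)
    have "c a t 0 j + c a t 1 j - c a t k j = c b t 0 j + c b t 1 j - c b t k j" if "t = 2 \<or> t = 3" for t
      using y23[where a = a and t = t and k = k and j = j, OF a]
        y23[where a = b and t = t and k = k and j = j, OF b] y_eq[of t]
        prev[OF that] that k less.prems by auto
    \<comment> \<open>The two equations fix \<open>S 1\<close> and \<open>S 0 + S 1\<close> for
      \<open>k = 0\<close>, \<open>S 0\<close> and \<open>S 1\<close> for \<open>k = 1\<close>, and
      \<open>S 0 + S 1\<close> and \<open>S 0 + 2 S 1\<close> otherwise; the determinants are 1 or
      -1.\<close>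
    from this[of 2] this[of 3] show ?case
      by (cases "k = 0"; cases "k = 1") (auto simp: c_def algebra_simps)
  qed
  \<comment> \<open>With \<open>S t\<close> known, the output at channel use \<open>t\<close> gives
    the own entry at \<open>j\<close> from the one at \<open>j - d\<close>.\<close>
  have sel: "sel t (a k) $ j = sel t (b k) $ j" if "t < 2" "j < m" for t j
    using that(2)
  proof (induction j rule: less_induct)
    case (less j)
    have "sel t (a k) $ (j - d) = sel t (b k) $ (j - d)" if "d \<le> j"
      using less that d by simp
    moreover have "S t a j = S t b j"
      using S[OF less.prems] \<open>t < 2\<close> by (auto simp: less_2_cases_iff)
    ultimately show ?case
      using y01[where a = a, OF a \<open>t < 2\<close> k less.prems] y01[where a = b, OF b \<open>t < 2\<close> k less.prems] y_eq[of t] by (auto split: if_splits)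
  qed
  show "a k = b k"
    using sel[of 0] sel[of 1] a[OF k] b[OF k] by (intro prod_eqI eq_vecI) (auto simp: sel_def)
qed

section \<open>Capacity as the common value of both bounds\<close>

text \<open>The strict inequality matches the block schemes, which reach every rate below
  \<open>c\<close>; density of the extended reals gives the supremum.\<close>

lemma sym_feedback_capacity_eqI:
  assumes "\<And>R. R < c \<Longrightarrow> achievable TYPE('f::{field,finite}) K n m (\<lambda>_. R)"
    and "\<And>R. achievable TYPE('f) K n m (\<lambda>_. R) \<Longrightarrow> R \<le> c"
  shows "sym_feedback_capacity TYPE('f) K n m = ereal c"
proof (rule antisym)
  show "sym_feedback_capacity TYPE('f) K n m \<le> ereal c"
    unfolding sym_feedback_capacity_def using assms(2) by (auto intro!: Sup_least)
  show "ereal c \<le> sym_feedback_capacity TYPE('f) K n m"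
  proof (rule dense_le)
    fix x assume "x < ereal c"
    then show "x \<le> sym_feedback_capacity TYPE('f) K n m"
      unfolding sym_feedback_capacity_def using assms(1) by (cases x) (auto intro!: Sup_upper)
  qed
qed

theorem theorem4:
  fixes K n m p :: nat
  assumes "K \<ge> 2"
    and "prime p"
    and "CARD('f::{field,finite}) = p"
  shows "sym_feedback_capacity TYPE('f) K n m =
    ereal (if n > m then real n - real m / 2
           else if m = n then real n / real K
           else real m / 2)"
proof (rule sym_feedback_capacity_eqI)
  fix R :: real
  assume "R < (if n > m then real n - real m / 2 else if m = n then real n / real K else real m / 2)"
  then show "achievable TYPE('f) K n m (\<lambda>_. R)"
    using achievable_strong_direct_link[of m n R K, where 'f = 'f] achievable_equal_gains[of K R n, where 'f = 'f]
      achievable_strong_cross_links[of K n m R, where 'f = 'f] \<open>K \<ge> 2\<close>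
    by (auto split: if_splits)
next
  fix R :: real
  assume ach: "achievable TYPE('f) K n m (\<lambda>_. R)"
  \<comment> \<open>The right-hand side is \<open>2 * n - m\<close> for \<open>n > m\<close> and
    \<open>m\<close> otherwise.\<close>
  have "card {0::nat, 1} * R \<le> max m n + (n - m)"
    using \<open>K \<ge> 2\<close> by (intro achievable_rate_le[OF ach _ card_two_users_correct_le]) auto
  \<comment> \<open>Two users would only give \<open>n / 2\<close> here. With \<open>S\<close> the
    set of all users, the product over the remaining messages is empty.\<close>
  moreover have "card {..<K} * R \<le> n" if "m = n"
    using card_all_users_correct_le[of K n, where 'f = 'f] \<open>K \<ge> 2\<close> that
    by (intro achievable_rate_le[OF ach]) auto
  ultimately show "R \<le> (if n > m then real n - real m / 2 else if m = n then real n / real K else real m / 2)"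
    using \<open>K \<ge> 2\<close> by (auto simp: field_simps max_def of_nat_diff)
qed

end
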